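(* Let $\nu>0$. For $N\ge2$, the matrix $S_N$ has the eigenvalues $2,4,\ldots,2N$. Moreover, for $k=0,1,\ldots,N-1$ and the eigenvalue $2(k+1)$, an eigenvector is given by $$\bigl(r_1P_k^{(N,\nu)}(r_1^2),\ldots,r_NP_k^{(N,\nu)}(r_N^2)\bigr)^T.$$ In particular, $S_N=T_N\cdot\mathrm{diag}(2,4,\ldots,2N)\cdot T_N^T$ with the orthogonal matrix $T_N=\bigl(r_i\,P_k^{(N,\nu)}(r_i^2)\bigr)_{i=1,\ldots,N,\;k=0,\ldots,N-1}$.
   Context: $z_{1,N}^{(\nu-1)}>\dots>z_{N,N}^{(\nu-1)}>0$ are the ordered zeros of the Laguerre polynomial $L_N^{(\nu-1)}$, the polynomials $(L_n^{(\nu-1)})_n$ being orthogonal with respect to the density $e^{-x}x^{\nu-1}$ on $(0,\infty)$. Put $r_i:=\sqrt{2z_{i,N}^{(\nu-1)}}$ for $i=1,\ldots,N$, so $r_1>\dots>r_N>0$. $S_N=(s_{i,j})_{i,j=1}^N$ is the matrix with $$s_{i,i}=1+\frac{2\nu}{r_i^2}+2\sum_{l\ne i}(r_i-r_l)^{-2}+2\sum_{l\ne i}(r_i+r_l)^{-2},\qquad s_{i,j}=2(r_i+r_j)^{-2}-2(r_i-r_j)^{-2}\ \ (i\ne j).$$ $(P_k^{(N,\nu)})_{k=0,\ldots,N-1}$ is the finite sequence of polynomials with $\deg P_k^{(N,\nu)}=k$ and positive leading coefficients that are orthogonal with respect to the probability measure $$\mu_{N,\nu}=\frac{1}{2N(N+\nu-1)}\sum_{i=1}^N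 2z_{i,N}^{(\nu-1)}\,\delta_{2z_{i,N}^{(\nu-1)}}$$ and normalized by $\sum_{i=1}^N 2z_{i,N}^{(\nu-1)}P_k^{(N,\nu)}(2z_{i,N}^{(\nu-1)})^2=1$ for $k=0,\ldots,N-1$. *)

theory Defs
  imports "HOL-Analysis.Analysis" "Jordan_Normal_Form.Spectral_Radius"
begin

text \<open>
  All indices of vectors and matrices start at 0, so the zeros
  \<open>z\<^sub>1 > \<dots> > z\<^sub>N\<close> are represented by \<open>z 0 > \<dots> > z (N - 1)\<close>.
\<close>

text \<open>
  The Laguerre polynomials \<open>L\<^sub>n\<close> with parameter \<open>\<alpha> > -1\<close>, up to normalization: the
  orthogonality relation determines each of them up to a nonzero constant factor, which does not
  affect the zeros. The condition \<open>L n \<noteq> 0\<close> is only relevant for \<open>n = 0\<close>, since the zero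
  polynomial has degree 0 in the library.
\<close>

definition laguerre_system :: "real \<Rightarrow> (nat \<Rightarrow> real poly) \<Rightarrow> bool" where
  "laguerre_system \<alpha> L \<longleftrightarrow>
     (\<forall>n. L n \<noteq> 0 \<and> degree (L n) = n) \<and>
     (\<forall>m n. m \<noteq> n \<longrightarrow>
        (LINT x:{0<..}|lborel. poly (L m) x * poly (L n) x * (exp (- x) * x powr \<alpha>)) = 0)"

definition ordered_positive_zeros :: "real poly \<Rightarrow> nat \<Rightarrow> (nat \<Rightarrow> real) \<Rightarrow> bool" where
  "ordered_positive_zeros p N z \<longleftrightarrow>
     {x. poly p x = 0} = z ` {..<N} \<and>
     (\<forall>i j. i < j \<and> j < N \<longrightarrow> z j < z i) \<and>
     (\<forall>i<N. 0 < z i)"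

definition S_mat :: "nat \<Rightarrow> real \<Rightarrow> (nat \<Rightarrow> real) \<Rightarrow> real mat" where
  "S_mat N \<nu> r = Matrix.mat N N (\<lambda>(i, j).
     if i = j then
       1 + 2 * \<nu> / (r i)\<^sup>2
         + 2 * (\<Sum>l\<in>{..<N} - {i}. 1 / (r i - r l)\<^sup>2)
         + 2 * (\<Sum>l\<in>{..<N} - {i}. 1 / (r i + r l)\<^sup>2)
     else 2 / (r i + r j)\<^sup>2 - 2 / (r i - r j)\<^sup>2)"

text \<open>
  The measure \<open>\<Sum>i<N. w\<^sub>i \<delta>(x\<^sub>i)\<close> with \<open>x\<^sub>i = 2 z\<^sub>i\<close> and \<open>w\<^sub>i = 2 z\<^sub>i / (2 N (N + \<nu> - 1))\<close>,
  written as the image of the weights on the index set under \<open>i \<mapsto> x\<^sub>i\<close>.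
\<close>

definition dual_measure :: "nat \<Rightarrow> real \<Rightarrow> (nat \<Rightarrow> real) \<Rightarrow> real measure" where
  "dual_measure N \<nu> z =
     distr (point_measure {..<N} (\<lambda>i. ennreal (2 * z i / (2 * real N * (real N + \<nu> - 1)))))
       borel (\<lambda>i. 2 * z i)"

lemma emeasure_dual_measure:
  assumes "A \<in> sets borel"
  shows "emeasure (dual_measure N \<nu> z) A =
    (\<Sum>i<N. ennreal (2 * z i / (2 * real N * (real N + \<nu> - 1))) * indicator A (2 * z i))"
proof -
  let ?w = "\<lambda>i. ennreal (2 * z i / (2 * real N * (real N + \<nu> - 1)))"
  have "emeasure (dual_measure N \<nu> z) A
      = emeasure (point_measure {..<N} ?w) ((\<lambda>i. 2 * z i) -` A \<inter> {..<N})"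
    unfolding dual_measure_def
    by (subst emeasure_distr) (use assms in \<open>auto simp: space_point_measure\<close>)
  also have "\<dots> = (\<Sum>i\<in>(\<lambda>i. 2 * z i) -` A \<inter> {..<N}. ?w i)"
    by (rule emeasure_point_measure_finite) auto
  also have "\<dots> = (\<Sum>i<N. ?w i * indicator A (2 * z i))"
    by (rule sum.mono_neutral_cong_left) (auto simp: indicator_def)
  finally show ?thesis .
qed

text \<open>Only \<open>P k\<close> for \<open>k < N\<close> is constrained.\<close>

definition dual_laguerre_system ::
    "nat \<Rightarrow> real \<Rightarrow> (nat \<Rightarrow> real) \<Rightarrow> (nat \<Rightarrow> real poly) \<Rightarrow> bool" where
  "dual_laguerre_system N \<nu> z P \<longleftrightarrow>
     (\<forall>k<N. degree (P k) = k \<and> 0 < lead_coeff (P k)) \<and>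
     (\<forall>j<N. \<forall>k<N. j \<noteq> k \<longrightarrow>
        (LINT x|dual_measure N \<nu> z. poly (P j) x * poly (P k) x) = 0) \<and>
     (\<forall>k<N. (\<Sum>i<N. 2 * z i * (poly (P k) (2 * z i))\<^sup>2) = 1)"

definition T_col :: "nat \<Rightarrow> (nat \<Rightarrow> real) \<Rightarrow> (nat \<Rightarrow> real poly) \<Rightarrow> nat \<Rightarrow> real vec" where
  "T_col N r P k = Matrix.vec N (\<lambda>i. r i * poly (P k) ((r i)\<^sup>2))"

definition T_mat :: "nat \<Rightarrow> (nat \<Rightarrow> real) \<Rightarrow> (nat \<Rightarrow> real poly) \<Rightarrow> real mat" where
  "T_mat N r P = Matrix.mat N N (\<lambda>(i, k). r i * poly (P k) ((r i)\<^sup>2))"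

text \<open>
  The library's \<^const>\<open>orthogonal_mat\<close> only asks for pairwise orthogonal nonzero columns, not for
  unit columns.
\<close>

definition real_orthogonal_mat :: "real mat \<Rightarrow> bool" where
  "real_orthogonal_mat A \<longleftrightarrow>
     square_mat A \<and> transpose_mat A * A = 1\<^sub>m (dim_row A) \<and> A * transpose_mat A = 1\<^sub>m (dim_row A)"

end

theory Submission
  imports Defs
begin

text \<open>
  Write \<open>x\<^sub>i = r\<^sub>i\<^sup>2 = 2 z\<^sub>i\<close>. On vectors of the form \<open>v\<^sub>i = r\<^sub>i p(x\<^sub>i)\<close> with a polynomial \<open>p\<close>, the
  matrix \<open>S\<close> acts through a linear operator \<open>A\<close> on polynomials: \<open>(S v)\<^sub>i = r\<^sub>i (A p)(x\<^sub>i)\<close>. Indeed, the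
  two terms with \<open>(r\<^sub>i \<plusminus> r\<^sub>l)\<^sup>-\<^sup>2\<close> combine to rational functions of \<open>x\<^sub>i\<close> and \<open>x\<^sub>l\<close>
  (\<open>pair_interaction_in_squares\<close>), which leaves the reciprocal sums \<open>\<Sum>\<^sub>l 1/(x\<^sub>i - x\<^sub>l)\<close> and
  second order difference quotients of \<open>p\<close>. The Laguerre differential equation
  \<open>x y'' + (\<nu> - x) y' + N y = 0\<close>, read at a zero of \<open>y = L\<^sub>N\<close>, evaluates the reciprocal sums as
  \<open>1/4 - \<nu>/(2 x\<^sub>i)\<close> (\<open>laguerre_zeros_sum_reciprocal\<close>); this cancels the term \<open>2\<nu>/x\<^sub>i\<close>, and the
  difference quotients become polynomials in \<open>x\<^sub>i\<close> (\<open>poly_node_operator\<close>).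

  Comparing leading coefficients, \<open>A\<close> maps \<open>x\<^sup>k\<close> to \<open>2 (k + 1) x\<^sup>k\<close> plus terms of lower degree
  (\<open>node_operator_triangular\<close>). As \<open>S\<close> is symmetric, \<open>A\<close> is symmetric with respect to the inner product
  \<open>\<langle>p, q\<rangle> = \<Sum>\<^sub>i x\<^sub>i p(x\<^sub>i) q(x\<^sub>i)\<close>, which is the Euclidean inner product of the corresponding vectors. A
  triangular symmetric operator is diagonal in the orthogonal basis that is adapted to the degree
  filtration: if \<open>p\<close> has degree \<open>k\<close> and is orthogonal to all polynomials of lower degree, then
  \<open>q = A p - 2 (k + 1) p\<close> has degree below \<open>k\<close>, and \<open>\<langle>q, q\<rangle> = \<langle>p, A q\<rangle> - 2 (k + 1) \<langle>p, q\<rangle> = 0\<close>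
  (\<open>eigenvector_of_orthogonal_polynomial\<close>). This applies to the polynomials \<open>P\<^sub>k\<close>; since such
  polynomials exist by the Gram-Schmidt process, the \<open>N\<close> values \<open>2, 4, \<dots>, 2N\<close> are eigenvalues, and an
  \<open>N \<times> N\<close> matrix has no further ones.
\<close>

section \<open>The degree filtration of polynomials\<close>

text \<open>
  The polynomials of degree less than \<open>n\<close>, by coefficients: \<open>degree q < n\<close> would exclude the zero
  polynomial for \<open>n = 0\<close>.
\<close>
definition polys_below :: "nat \<Rightarrow> 'a::zero poly set" where
  "polys_below n = {q. \<forall>j\<ge>n. coeff q j = 0}"

lemma polys_below_0 [simp]: "polys_below 0 = {0}"
  by (auto simp: polys_below_def poly_eq_iff)

lemma polys_belowD: "q \<in> polys_below n \<Longrightarrow> n \<le> j \<Longrightarrow> coeff q j = 0"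
  by (simp add: polys_below_def)

lemma polys_below_mono: "q \<in> polys_below m \<Longrightarrow> m \<le> n \<Longrightarrow> q \<in> polys_below n"
  by (auto simp: polys_below_def)

lemma polys_below_Suc_iff: "q \<in> polys_below (Suc n) \<longleftrightarrow> degree q \<le> n"
proof
  assume "q \<in> polys_below (Suc n)"
  then show "degree q \<le> n"
    by (intro degree_le) (auto simp: polys_below_def)
next
  assume "degree q \<le> n"
  then show "q \<in> polys_below (Suc n)"
    by (auto simp: polys_below_def intro!: coeff_eq_0)
qed

lemma polys_below_Suc_cancel:
  fixes p q :: "'a::ab_group_add poly"
  assumes "p \<in> polys_below (Suc n)" "q \<in> polys_below (Suc n)" "coeff p n = coeff q n"
  shows "p - q \<in> polys_below n"
proof -
  have "coeff (p - q) j = 0" if "j \<ge> n" for j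
    using assms that by (cases "j = n") (auto simp: polys_below_def)
  then show ?thesis by (simp add: polys_below_def)
qed

text \<open>
  A family with one polynomial of each degree is a basis, so orthogonality to all polynomials of lower
  degree only has to be checked on such a family. Both orthogonality relations of the theorem, for an
  integral and for a finite sum, are used through this lemma.
\<close>
lemma linear_functional_eq_0_on_polys_below:
  fixes \<Lambda> :: "'a::field poly \<Rightarrow> 'a" and B :: "nat \<Rightarrow> 'a poly"
  assumes add: "\<And>p q. \<Lambda> (p + q) = \<Lambda> p + \<Lambda> q"
    and scale: "\<And>c p. \<Lambda> (Polynomial.smult c p) = c * \<Lambda> p"
    and basis: "\<And>j. j < k \<Longrightarrow> B j \<noteq> 0 \<and> degree (B j) = j"
    and zero: "\<And>j. j < k \<Longrightarrow> \<Lambda> (B j) = 0"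
    and q: "q \<in> polys_below k"
  shows "\<Lambda> q = 0"
  using basis zero q
proof (induction k arbitrary: q)
  case 0
  then show ?case using scale[of 0 0] by simp
next
  case (Suc k)
  have Bk: "B k \<noteq> 0" "degree (B k) = k" using Suc.prems(1)[of k] by auto
  then have lc: "coeff (B k) k \<noteq> 0" by (metis leading_coeff_0_iff)
  define c where "c = coeff q k / coeff (B k) k"
  have "q - Polynomial.smult c (B k) \<in> polys_below k"
  proof (rule polys_below_Suc_cancel)
    show "Polynomial.smult c (B k) \<in> polys_below (Suc k)"
      using Bk(2) by (metis degree_smult_le polys_below_Suc_iff)
    show "coeff q k = coeff (Polynomial.smult c (B k)) k"
      using lc by (simp add: c_def)
  qed (rule Suc.prems(3))
  then have "\<Lambda> (q - Polynomial.smult c (B k)) = 0"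
    using Suc.IH[of "q - Polynomial.smult c (B k)", OF Suc.prems(1,2)] by (simp only: less_SucI)
  moreover have "\<Lambda> q = \<Lambda> (q - Polynomial.smult c (B k)) + c * \<Lambda> (B k)"
    using add[of "q - Polynomial.smult c (B k)" "Polynomial.smult c (B k)"] by (simp add: scale)
  moreover have "\<Lambda> (B k) = 0" by (rule Suc.prems(2)) simp
  ultimately show ?case by simp
qed

section \<open>The Laguerre differential equation\<close>

definition laguerre_moment :: "real \<Rightarrow> real poly \<Rightarrow> real" where
  "laguerre_moment \<nu> p = (LINT x:{0<..}|lborel. poly p x * (exp (- x) * x powr (\<nu> - 1)))"

lemma has_bochner_integral_gamma_density:
  fixes s :: real
  assumes "s > 0"
  shows "has_bochner_integral lborel (\<lambda>x. indicator {0<..} x * (exp (- x) * x powr (s - 1))) (Gamma s)"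
proof (rule has_bochner_integral_nn_integral)
  have "(\<integral>\<^sup>+ x. ennreal (indicator {0<..} x * (exp (- x) * x powr (s - 1))) \<partial>lborel)
      = (\<integral>\<^sup>+ x. ennreal (indicator {0..} x * x powr (s - 1) / exp x) \<partial>lborel)"
    by (intro nn_integral_cong) (auto simp: indicator_def exp_minus field_simps)
  also have "\<dots> = ennreal (Gamma s)"
    using Gamma_conv_nn_integral_real[OF assms] by simp
  finally show "(\<integral>\<^sup>+ x. ennreal (indicator {0<..} x * (exp (- x) * x powr (s - 1))) \<partial>lborel)
      = ennreal (Gamma s)" .
qed (use assms in \<open>auto simp: Gamma_real_pos less_imp_le\<close>)

lemma has_bochner_integral_laguerre_moment:
  assumes "\<nu> > 0"
  shows "has_bochner_integral lborel
      (\<lambda>x. indicator {0<..} x * (poly p x * (exp (- x) * x powr (\<nu> - 1))))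
      (\<Sum>k\<le>degree p. coeff p k * Gamma (\<nu> + real k))"
proof -
  have "has_bochner_integral lborel
      (\<lambda>x. \<Sum>k\<le>degree p. coeff p k * (indicator {0<..} x * (exp (- x) * x powr (\<nu> + real k - 1))))
      (\<Sum>k\<le>degree p. coeff p k * Gamma (\<nu> + real k))"
    using assms
    by (intro has_bochner_integral_sum has_bochner_integral_mult_right
          has_bochner_integral_gamma_density) auto
  also have "(\<lambda>x. \<Sum>k\<le>degree p. coeff p k * (indicator {0<..} x * (exp (- x) * x powr (\<nu> + real k - 1))))
      = (\<lambda>x. indicator {0<..} x * (poly p x * (exp (- x) * x powr (\<nu> - 1))))"
  proof
    fix x :: real
    have "x powr (\<nu> + real k - 1) = x ^ k * x powr (\<nu> - 1)" if "x > 0" for k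
      using that powr_add[of x "real k" "\<nu> - 1"] by (simp add: powr_realpow algebra_simps)
    then show "(\<Sum>k\<le>degree p. coeff p k * (indicator {0<..} x * (exp (- x) * x powr (\<nu> + real k - 1))))
      = indicator {0<..} x * (poly p x * (exp (- x) * x powr (\<nu> - 1)))"
      by (cases "x > 0") (auto simp: poly_altdef sum_distrib_left sum_distrib_right mult_ac intro!: sum.cong)
  qed
  finally show ?thesis .
qed

lemma laguerre_moment_coeffs:
  assumes "\<nu> > 0" "degree p \<le> n"
  shows "laguerre_moment \<nu> p = (\<Sum>k\<le>n. coeff p k * Gamma (\<nu> + real k))"
proof -
  have "laguerre_moment \<nu> p = (\<Sum>k\<le>degree p. coeff p k * Gamma (\<nu> + real k))"
    using has_bochner_integral_integral_eq[OF has_bochner_integral_laguerre_moment[OF assms(1), of p]]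
    by (simp add: laguerre_moment_def set_lebesgue_integral_def)
  also have "\<dots> = (\<Sum>k\<le>n. coeff p k * Gamma (\<nu> + real k))"
    using assms(2) by (intro sum.mono_neutral_left) (auto simp: coeff_eq_0)
  finally show ?thesis .
qed

lemma laguerre_moment_add:
  assumes "\<nu> > 0"
  shows "laguerre_moment \<nu> (p + q) = laguerre_moment \<nu> p + laguerre_moment \<nu> q"
  using assms laguerre_moment_coeffs[of \<nu> _ "max (degree p) (degree q)"]
  by (simp add: degree_add_le_max sum.distrib algebra_simps)

lemma laguerre_moment_smult:
  assumes "\<nu> > 0"
  shows "laguerre_moment \<nu> (Polynomial.smult c p) = c * laguerre_moment \<nu> p"
  using assms by (simp add: laguerre_moment_coeffs[of \<nu> _ "degree p"] sum_distrib_left mult_ac)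

lemma laguerre_moment_monom:
  assumes "\<nu> > 0"
  shows "laguerre_moment \<nu> (monom c n) = c * Gamma (\<nu> + real n)"
proof -
  have "laguerre_moment \<nu> (monom c n) = (\<Sum>k\<le>n. coeff (monom c n) k * Gamma (\<nu> + real k))"
    using assms by (intro laguerre_moment_coeffs degree_monom_le)
  also have "\<dots> = (\<Sum>k\<le>n. if k = n then c * Gamma (\<nu> + real n) else 0)"
    by (intro sum.cong) auto
  finally show ?thesis by simp
qed

text \<open>
  Integration by parts for the weight: \<open>(x\<^sup>\<nu> e\<^sup>-\<^sup>x p)' = x\<^sup>\<nu>\<^sup>-\<^sup>1 e\<^sup>-\<^sup>x (x p' + (\<nu> - x) p)\<close> has integral 0. No
  boundary terms have to be estimated, since on monomials the identity is the functional equation of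
  the Gamma function.
\<close>
lemma laguerre_moment_parts:
  assumes "\<nu> > 0"
  shows "laguerre_moment \<nu> ([:0, 1:] * pderiv p + [:\<nu>, -1:] * p) = 0"
proof (rule linear_functional_eq_0_on_polys_below[where k = "Suc (degree p)" and q = p and B = "monom 1"])
  fix p q :: "real poly"
  have "[:0, 1:] * pderiv (p + q) + [:\<nu>, -1:] * (p + q)
      = ([:0, 1:] * pderiv p + [:\<nu>, -1:] * p) + ([:0, 1:] * pderiv q + [:\<nu>, -1:] * q)"
    by (simp only: pderiv_add distrib_left add_ac)
  then show "laguerre_moment \<nu> ([:0, 1:] * pderiv (p + q) + [:\<nu>, -1:] * (p + q))
      = laguerre_moment \<nu> ([:0, 1:] * pderiv p + [:\<nu>, -1:] * p)
        + laguerre_moment \<nu> ([:0, 1:] * pderiv q + [:\<nu>, -1:] * q)"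
    using laguerre_moment_add[OF assms] by simp
next
  fix c and p :: "real poly"
  have "[:0, 1:] * pderiv (Polynomial.smult c p) + [:\<nu>, -1:] * Polynomial.smult c p
      = Polynomial.smult c ([:0, 1:] * pderiv p + [:\<nu>, -1:] * p)"
    by (simp only: pderiv_smult mult_smult_right smult_add_right)
  then show "laguerre_moment \<nu> ([:0, 1:] * pderiv (Polynomial.smult c p) + [:\<nu>, -1:] * Polynomial.smult c p)
      = c * laguerre_moment \<nu> ([:0, 1:] * pderiv p + [:\<nu>, -1:] * p)"
    using laguerre_moment_smult[OF assms] by simp
next
  fix j
  have *: "[:0, 1:] * pderiv (monom 1 j) + [:\<nu>, -1:] * monom 1 j
      = monom (\<nu> + real j) j + monom (-1) (Suc j)"
    by (intro poly_eqI) (auto simp: pderiv_monom coeff_pCons split: nat.split)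
  have "\<nu> + real j \<notin> \<int>\<^sub>\<le>\<^sub>0" using assms by (auto elim!: nonpos_Ints_cases)
  then have "Gamma (\<nu> + real (Suc j)) = (\<nu> + real j) * Gamma (\<nu> + real j)"
    using Gamma_plus1[of "\<nu> + real j"] by (simp add: add_ac)
  then show "laguerre_moment \<nu> ([:0, 1:] * pderiv (monom 1 j) + [:\<nu>, -1:] * monom 1 j) = 0"
    unfolding * using assms by (simp add: laguerre_moment_add laguerre_moment_monom)
qed (auto simp: degree_monom_eq polys_below_Suc_iff)

text \<open>
  The right-hand side is symmetric in \<open>p\<close> and \<open>q\<close>, so the Laguerre operator
  \<open>x p'' + (\<nu> - x) p'\<close> is self-adjoint for the weight.
\<close>
lemma laguerre_moment_pderiv_symmetric:
  assumes "\<nu> > 0"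
  shows "laguerre_moment \<nu> (([:0, 1:] * pderiv (pderiv p) + [:\<nu>, -1:] * pderiv p) * q)
    = - laguerre_moment \<nu> ([:0, 1:] * pderiv p * pderiv q)"
proof -
  have "[:0, 1:] * pderiv (pderiv p * q) + [:\<nu>, -1:] * (pderiv p * q)
    = ([:0, 1:] * pderiv (pderiv p) + [:\<nu>, -1:] * pderiv p) * q + [:0, 1:] * pderiv p * pderiv q"
    by (simp only: pderiv_mult algebra_simps)
  with laguerre_moment_parts[OF assms, of "pderiv p * q"] show ?thesis
    by (simp only: laguerre_moment_add[OF assms]) 
qed

lemma laguerre_moment_square_eq_0_iff:
  assumes "\<nu> > 0"
  shows "laguerre_moment \<nu> (p * p) = 0 \<longleftrightarrow> p = 0"
proof
  let ?f = "\<lambda>x. indicator {0<..} x * (poly (p * p) x * (exp (- x) * x powr (\<nu> - 1)))"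
  assume "laguerre_moment \<nu> (p * p) = 0"
  moreover have "integrable lborel ?f"
    using has_bochner_integral_laguerre_moment[OF assms, of "p * p"] by (rule integrable.intros)
  ultimately have "AE x in lborel. ?f x = 0"
    by (subst integral_nonneg_eq_0_iff_AE[symmetric])
       (auto simp: laguerre_moment_def set_lebesgue_integral_def)
  then have *: "AE x in lborel. x > 0 \<longrightarrow> poly p x = 0"
    by eventually_elim (auto simp: indicator_def)
  show "p = 0"
  proof (rule ccontr)
    assume "p \<noteq> 0"
    then have "finite {x. poly p x = 0}" by (rule poly_roots_finite)
    then have "AE x in lborel. x \<notin> {x. poly p x = 0}"
      by (intro AE_not_in countable_imp_null_set_lborel countable_finite)
    with * have "AE x in lborel. x \<notin> {0<..<1::real}"
      by eventually_elim auto
    then have "emeasure lborel {0<..<1::real} = 0"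
      by (subst (asm) AE_iff_measurable[where N = "{0<..<1}"]) auto
    then show False by simp
  qed
qed (use laguerre_moment_smult[OF assms, of 0 0] in simp)

lemma laguerre_system_orthogonal:
  assumes "\<nu> > 0" "laguerre_system (\<nu> - 1) L" "f \<in> polys_below n"
  shows "laguerre_moment \<nu> (L n * f) = 0"
proof (rule linear_functional_eq_0_on_polys_below[where k = n and q = f and B = L])
  show "laguerre_moment \<nu> (L n * L j) = 0" if "j < n" for j
    using assms(2) that by (auto simp: laguerre_system_def laguerre_moment_def)
  show "L j \<noteq> 0 \<and> degree (L j) = j" for j
    using assms(2) by (auto simp: laguerre_system_def)
qed (use assms in \<open>simp_all add: distrib_left laguerre_moment_add laguerre_moment_smult\<close>)

text \<open>
  The Laguerre operator \<open>D\<close> preserves the degree filtration, and it acts on the leading coefficient in degree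
  \<open>n\<close> by \<open>- n\<close>. Hence \<open>e = D L\<^sub>n + n L\<^sub>n\<close> has degree less than \<open>n\<close>, and self-adjointness makes it
  orthogonal to everything of degree less than \<open>n\<close>, in particular to itself.
\<close>
lemma laguerre_differential_equation:
  assumes "\<nu> > 0" "laguerre_system (\<nu> - 1) L"
  shows "[:0, 1:] * pderiv (pderiv (L n)) + [:\<nu>, -1:] * pderiv (L n) + Polynomial.smult (real n) (L n) = 0"
proof -
  define D :: "real poly \<Rightarrow> real poly"
    where "D p = [:0, 1:] * pderiv (pderiv p) + [:\<nu>, -1:] * pderiv p" for p
  define e where "e = D (L n) + Polynomial.smult (real n) (L n)"
  have coeff_D: "coeff (D p) j = real (Suc j) * (\<nu> + real j) * coeff p (Suc j) - real j * coeff p j" for p j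
    by (cases j) (auto simp: D_def coeff_pderiv algebra_simps)
  have deg: "degree (L n) = n" using assms(2) by (simp add: laguerre_system_def)
  have below: "D f \<in> polys_below n" if "f \<in> polys_below n" for f n
    using that by (auto simp: polys_below_def coeff_D)
  have e: "e \<in> polys_below n"
  proof -
    have "coeff e j = 0" if "j \<ge> n" for j
      using that deg by (cases "j = n") (auto simp: e_def coeff_D coeff_eq_0)
    then show ?thesis by (simp add: polys_below_def)
  qed
  have "laguerre_moment \<nu> (D (L n) * e) = laguerre_moment \<nu> (L n * D e)"
    using laguerre_moment_pderiv_symmetric[OF assms(1), of "L n" e]
      laguerre_moment_pderiv_symmetric[OF assms(1), of e "L n"]
    by (simp only: D_def mult_ac)
  also have "\<dots> = 0"
    by (intro laguerre_system_orthogonal assms below e)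
  finally have "laguerre_moment \<nu> (D (L n) * e) = 0" .
  moreover have "laguerre_moment \<nu> (L n * e) = 0"
    by (intro laguerre_system_orthogonal assms e)
  moreover have "e * e = D (L n) * e + Polynomial.smult (real n) (L n * e)"
    by (subst (1) e_def) (simp add: distrib_right)
  ultimately have "laguerre_moment \<nu> (e * e) = 0"
    by (simp add: laguerre_moment_add laguerre_moment_smult assms(1))
  then show ?thesis
    using laguerre_moment_square_eq_0_iff[OF assms(1)] by (simp add: e_def D_def)
qed

section \<open>Reciprocal sums over the Laguerre zeros\<close>

text \<open>
  With \<open>y = (x - z\<^sub>i) g\<close> the derivatives at \<open>z\<^sub>i\<close> are \<open>y' = g\<close> and \<open>y'' = 2 g'\<close>, and the sum is the
  logarithmic derivative \<open>g'/g\<close> at \<open>z\<^sub>i\<close>.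
\<close>
lemma pderiv2_at_simple_root:
  fixes y :: "real poly" and z :: "'i \<Rightarrow> real"
  assumes y: "y = Polynomial.smult c (\<Prod>l\<in>I. [:- z l, 1:])" and "finite I" "i \<in> I" "inj_on z I"
  shows "poly (pderiv (pderiv y)) (z i)
    = 2 * poly (pderiv y) (z i) * (\<Sum>l\<in>I - {i}. 1 / (z i - z l))"
proof -
  define g where "g = Polynomial.smult c (\<Prod>l\<in>I - {i}. [:- z l, 1:])"
  have split: "y = [:- z i, 1:] * g"
    using assms(2,3) unfolding y g_def by (simp add: prod.remove)
  have "poly (pderiv y) (z i) = poly g (z i)"
    unfolding split by (simp only: pderiv_mult) (simp add: pderiv_pCons)
  moreover have "poly (pderiv (pderiv y)) (z i) = 2 * poly (pderiv g) (z i)"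
    unfolding split by (simp only: pderiv_mult pderiv_add) (simp add: pderiv_pCons)
  moreover have "poly (pderiv g) (z i) = poly g (z i) * (\<Sum>l\<in>I - {i}. 1 / (z i - z l))"
  proof -
    have "poly (\<Prod>m\<in>I - {i} - {l}. [:- z m, 1:]) (z i)
        = poly (\<Prod>m\<in>I - {i}. [:- z m, 1:]) (z i) / (z i - z l)" if "l \<in> I - {i}" for l
    proof -
      have "z i \<noteq> z l" using that assms(3,4) by (auto simp: inj_on_def)
      then show ?thesis
        using that assms(2) by (simp add: prod.remove[of "I - {i}" l] divide_simps algebra_simps)
    qed
    then show ?thesis
      by (simp add: g_def pderiv_smult pderiv_prod pderiv_pCons poly_sum sum_distrib_left)
  qed
  ultimately show ?thesis by simp
qed

lemma poly_eq_smult_prod_roots: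
  fixes p :: "'a::idom poly"
  assumes "finite I" "inj_on z I" "degree p = card I" "\<And>i. i \<in> I \<Longrightarrow> poly p (z i) = 0"
  shows "p = Polynomial.smult (lead_coeff p) (\<Prod>i\<in>I. [:- z i, 1:])"
proof (rule poly_eqI_degree_lead_coeff[where A = "z ` I" and n = "card I"])
  have deg: "degree (\<Prod>i\<in>I. [:- z i, 1:]) = card I"
    by (subst degree_prod_sum_eq) auto
  moreover have "lead_coeff (\<Prod>i\<in>I. [:- z i, 1:]) = 1"
    by (simp add: lead_coeff_prod)
  ultimately show "coeff p (card I) = coeff (Polynomial.smult (lead_coeff p) (\<Prod>i\<in>I. [:- z i, 1:])) (card I)"
    using assms(3) by simp
  show "degree (Polynomial.smult (lead_coeff p) (\<Prod>i\<in>I. [:- z i, 1:])) \<le> card I"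
    using degree_smult_le deg by metis
  show "poly p x = poly (Polynomial.smult (lead_coeff p) (\<Prod>i\<in>I. [:- z i, 1:])) x" if "x \<in> z ` I" for x
    using that assms(1,4) by (auto simp: poly_prod prod_zero_iff)
qed (use assms in \<open>auto simp: card_image\<close>)

lemma pderiv_at_simple_root_nonzero:
  fixes y :: "real poly" and z :: "'i \<Rightarrow> real"
  assumes y: "y = Polynomial.smult c (\<Prod>l\<in>I. [:- z l, 1:])" "c \<noteq> 0" and "finite I" "i \<in> I" "inj_on z I"
  shows "poly (pderiv y) (z i) \<noteq> 0"
proof -
  have split: "y = [:- z i, 1:] * Polynomial.smult c (\<Prod>l\<in>I - {i}. [:- z l, 1:])"
    using assms(3,4) unfolding y by (simp add: prod.remove)
  have "poly (pderiv y) (z i) = c * (\<Prod>l\<in>I - {i}. z i - z l)"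
    unfolding split by (simp only: pderiv_mult) (simp add: pderiv_pCons poly_prod)
  then show ?thesis using assms by (auto simp: inj_on_def)
qed

text \<open>
  The equilibrium relation of Stieltjes: at a zero the differential equation reduces to
  \<open>z\<^sub>i y'' + (\<nu> - z\<^sub>i) y' = 0\<close>, where \<open>y' \<noteq> 0\<close> and \<open>y''/y'\<close> is twice the reciprocal sum.
\<close>
lemma laguerre_zeros_sum_reciprocal:
  assumes "\<nu> > 0" "laguerre_system (\<nu> - 1) L" "ordered_positive_zeros (L N) N z" "i < N"
  shows "(\<Sum>l\<in>{..<N} - {i}. 1 / (z i - z l)) = 1 / 2 - \<nu> / (2 * z i)"
proof -
  have pos: "z i > 0" and inj: "inj_on z {..<N}"
    using assms(3,4) unfolding ordered_positive_zeros_def inj_on_def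
    by (auto) (metis less_irrefl nat_neq_iff)
  have root: "poly (L N) (z l) = 0" if "l < N" for l
    using assms(3) that unfolding ordered_positive_zeros_def by blast
  have "degree (L N) = N" "L N \<noteq> 0" using assms(2) by (auto simp: laguerre_system_def)
  then have fact: "L N = Polynomial.smult (lead_coeff (L N)) (\<Prod>l<N. [:- z l, 1:])" "lead_coeff (L N) \<noteq> 0"
    using poly_eq_smult_prod_roots[OF _ inj, of "L N"] root by auto
  define s where "s = (\<Sum>l\<in>{..<N} - {i}. 1 / (z i - z l))"
  have "poly (pderiv (L N)) (z i) \<noteq> 0"
    using pderiv_at_simple_root_nonzero[OF fact _ _ inj] assms(4) by auto
  moreover have "poly (pderiv (pderiv (L N))) (z i) = 2 * poly (pderiv (L N)) (z i) * s"
    using pderiv2_at_simple_root[OF fact(1) _ _ inj] assms(4) by (auto simp: s_def)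
  moreover have "z i * poly (pderiv (pderiv (L N))) (z i) + (\<nu> - z i) * poly (pderiv (L N)) (z i) = 0"
    using arg_cong[OF laguerre_differential_equation[OF assms(1,2), of N], of "\<lambda>p. poly p (z i)"] root[OF assms(4)]
    by (simp add: algebra_simps)
  ultimately have "poly (pderiv (L N)) (z i) * (2 * z i * s + (\<nu> - z i)) = 0"
    by (simp add: algebra_simps)
  with \<open>poly (pderiv (L N)) (z i) \<noteq> 0\<close> have "2 * z i * s + (\<nu> - z i) = 0" by simp
  with pos show ?thesis unfolding s_def[symmetric] by (simp add: field_simps)
qed

section \<open>Divided differences\<close>

text \<open>
  The quotient \<open>synthetic_div p y\<close> is the divided difference \<open>(p(x) - p(y))/(x - y)\<close> as a
  polynomial in \<open>x\<close>. Its value and its derivative at \<open>x = y\<close> are the Taylor coefficients of \<open>p\<close> at \<open>y\<close>.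
\<close>
lemma poly_synthetic_div_mult:
  fixes p :: "'a::comm_ring_1 poly"
  shows "(x - y) * poly (synthetic_div p y) x = poly p x - poly p y"
  using arg_cong[OF synthetic_div_correct'[of y p], of "\<lambda>q. poly q x"] by (simp add: algebra_simps)

lemma poly_synthetic_div_diagonal:
  fixes p :: "'a::idom poly"
  shows "poly (synthetic_div p y) y = poly (pderiv p) y"
proof -
  have "pderiv p = pderiv ([:- y, 1:] * synthetic_div p y + [:poly p y:])"
    by (simp only: synthetic_div_correct')
  also have "\<dots> = synthetic_div p y + [:- y, 1:] * pderiv (synthetic_div p y)"
    by (simp only: pderiv_add pderiv_mult) (simp add: pderiv_pCons)
  finally have "poly (pderiv p) y = poly (synthetic_div p y + [:- y, 1:] * pderiv (synthetic_div p y)) y"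
    by (rule arg_cong)
  then show ?thesis by simp
qed

lemma poly_pderiv_synthetic_div_diagonal:
  fixes p :: "'a::field_char_0 poly"
  shows "poly (pderiv (synthetic_div p y)) y = poly (pderiv (pderiv p)) y / 2"
proof -
  have "pderiv (pderiv p) = pderiv (pderiv ([:- y, 1:] * synthetic_div p y + [:poly p y:]))"
    by (simp only: synthetic_div_correct')
  also have "\<dots> = 2 * pderiv (synthetic_div p y) + [:- y, 1:] * pderiv (pderiv (synthetic_div p y))"
    by (simp only: pderiv_add pderiv_mult) (simp add: pderiv_pCons pderiv_add algebra_simps)
  finally have "poly (pderiv (pderiv p)) y
      = poly (2 * pderiv (synthetic_div p y) + [:- y, 1:] * pderiv (pderiv (synthetic_div p y))) y"
    by (rule arg_cong)
  then show ?thesis by simp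
qed

text \<open>
  With the divided difference \<open>s\<close> of \<open>p\<close>, this is the polynomial \<open>(x p'(x) - y s(x))/(x - y)\<close> in \<open>x\<close>; the
  numerator vanishes at \<open>x = y\<close>. Up to sign, it is the polynomial part that is left after the pole
  \<open>x p'(x)/(x - y)\<close> has been split off from the second order quotient
  \<open>y (p(x) - p(y))/(x - y)\<^sup>2\<close>. The name refers to the Euler operator \<open>x p'\<close>.
\<close>
definition euler_quotient :: "'a::field poly \<Rightarrow> 'a \<Rightarrow> 'a poly" where
  "euler_quotient p y =
     synthetic_div (pCons 0 (pderiv p) - Polynomial.smult y (synthetic_div p y)) y"

lemma poly_euler_quotient:
  assumes "x \<noteq> y"
  shows "poly (euler_quotient p y) x
    = x * poly (pderiv p) x / (x - y) - y * (poly p x - poly p y) / (x - y)\<^sup>2"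
proof -
  have "(x - y) * poly (euler_quotient p y) x = x * poly (pderiv p) x - y * poly (synthetic_div p y) x"
    by (simp add: euler_quotient_def poly_synthetic_div_mult poly_synthetic_div_diagonal)
  moreover have "poly (synthetic_div p y) x = (poly p x - poly p y) / (x - y)"
    using poly_synthetic_div_mult[of x y p] assms by (simp add: field_simps)
  ultimately have "poly (euler_quotient p y) x
      = (x * poly (pderiv p) x - y * ((poly p x - poly p y) / (x - y))) / (x - y)"
    using assms by (simp add: eq_divide_eq mult.commute)
  also have "\<dots> = x * poly (pderiv p) x / (x - y) - y * (poly p x - poly p y) / (x - y)\<^sup>2"
    by (simp only: diff_divide_distrib[of "_ * _"] times_divide_eq_right divide_divide_eq_left power2_eq_square)
  finally show ?thesis .
qed

lemma poly_euler_quotient_diagonal: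
  fixes p :: "'a::field_char_0 poly"
  shows "poly (euler_quotient p y) y = poly (pderiv p) y + y * poly (pderiv (pderiv p)) y / 2"
  by (simp add: euler_quotient_def poly_synthetic_div_diagonal poly_pderiv_synthetic_div_diagonal
      pderiv_diff pderiv_smult pderiv_pCons)

lemma synthetic_div_polys_below:
  "p \<in> polys_below (Suc n) \<Longrightarrow> synthetic_div p y \<in> polys_below n"
  by (cases n) (auto simp: polys_below_Suc_iff degree_synthetic_div synthetic_div_eq_0_iff)

lemma euler_quotient_polys_below:
  assumes "degree p \<le> k"
  shows "euler_quotient p y \<in> polys_below k"
  unfolding euler_quotient_def
proof (rule synthetic_div_polys_below)
  have "degree (pCons 0 (pderiv p)) \<le> k"
    using assms by (intro degree_le) (auto simp: coeff_pCons coeff_pderiv coeff_eq_0 split: nat.split)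
  moreover have "degree (Polynomial.smult y (synthetic_div p y)) \<le> k"
    using assms degree_smult_le[of y "synthetic_div p y"] by (simp add: degree_synthetic_div)
  ultimately show "pCons 0 (pderiv p) - Polynomial.smult y (synthetic_div p y) \<in> polys_below (Suc k)"
    by (simp add: polys_below_Suc_iff degree_diff_le)
qed

section \<open>The action of the matrix on polynomials\<close>

text \<open>
  The operator \<open>A\<close> with \<open>S (r\<^sub>i p(x\<^sub>i))\<^sub>i = (r\<^sub>i (A p)(x\<^sub>i))\<^sub>i\<close>. The linear factor
  \<open>x/4 - \<nu>/2 = x (1/4 - \<nu>/(2 x))\<close> comes from the reciprocal sum. The sum over all nodes also contains the
  index \<open>l = i\<close>, so that it does not depend on \<open>i\<close>; the term \<open>p' + x p''/2\<close>, which is the value of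
  the quotient on the diagonal, compensates for that.
\<close>
definition node_operator :: "real \<Rightarrow> nat \<Rightarrow> (nat \<Rightarrow> real) \<Rightarrow> real poly \<Rightarrow> real poly" where
  "node_operator \<nu> N x p =
     Polynomial.smult 2 p
     + Polynomial.smult 8 ([:- \<nu> / 2, 1 / 4:] * pderiv p
         + (pderiv p + Polynomial.smult (1 / 2) (pCons 0 (pderiv (pderiv p))))
         - (\<Sum>l<N. euler_quotient p (x l)))"

text \<open>
  All summands lower the degree, except \<open>2 p\<close> and \<open>8 \<sqdot> (x/4) p' = 2 x p'\<close>, which contribute \<open>2\<close> and
  \<open>2 k\<close> to the eigenvalue.
\<close>
lemma node_operator_triangular:
  assumes "degree p \<le> k"
  shows "node_operator \<nu> N x p - Polynomial.smult (2 * (real k + 1)) p \<in> polys_below k"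
  unfolding polys_below_def
proof safe
  fix j assume j: "k \<le> j"
  have "coeff (euler_quotient p y) j = 0" for y
    using euler_quotient_polys_below[OF assms] j by (rule polys_belowD)
  moreover have "coeff p (Suc j) = 0" "coeff p (Suc (Suc j)) = 0" "j \<noteq> k \<Longrightarrow> coeff p j = 0"
    using assms j by (auto intro!: coeff_eq_0)
  ultimately show "coeff (node_operator \<nu> N x p - Polynomial.smult (2 * (real k + 1)) p) j = 0"
    by (cases "j = k")
       (auto simp: node_operator_def coeff_sum coeff_pCons coeff_pderiv algebra_simps split: nat.split)
qed

lemma node_operator_degree:
  assumes "q \<in> polys_below k"
  shows "node_operator \<nu> N x q \<in> polys_below k"
proof (cases k)
  case 0
  then show ?thesis
    using assms node_operator_triangular[of q 0 \<nu> N x] by simp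
next
  case (Suc m)
  then have q: "degree q \<le> m" using assms by (simp add: polys_below_Suc_iff)
  have "node_operator \<nu> N x q - Polynomial.smult (2 * (real m + 1)) q \<in> polys_below (Suc m)"
    using node_operator_triangular[OF q] by (rule polys_below_mono) simp
  moreover have "Polynomial.smult (2 * (real m + 1)) q \<in> polys_below (Suc m)"
    using q degree_smult_le[of "2 * (real m + 1)" q] unfolding polys_below_Suc_iff by linarith
  ultimately show ?thesis
    unfolding Suc polys_below_def by auto
qed

text \<open>
  Summing the decomposition of \<open>poly_euler_quotient\<close> over the other nodes turns the poles into
  \<open>x\<^sub>i p'(x\<^sub>i)\<close> times the reciprocal sum.
\<close>
lemma poly_node_operator:
  assumes "i < N" "inj_on x {..<N}" "x i \<noteq> 0"
    and nodes: "(\<Sum>l\<in>{..<N} - {i}. 1 / (x i - x l)) = 1 / 4 - \<nu> / (2 * x i)"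
  shows "poly (node_operator \<nu> N x p) (x i)
    = 2 * poly p (x i)
      + 8 * (\<Sum>l\<in>{..<N} - {i}. x l * (poly p (x i) - poly p (x l)) / (x i - x l)\<^sup>2)"
proof -
  define s where "s = (\<Sum>l\<in>{..<N} - {i}. x l * (poly p (x i) - poly p (x l)) / (x i - x l)\<^sup>2)"
  have "(\<Sum>l<N. poly (euler_quotient p (x l)) (x i))
      = poly (euler_quotient p (x i)) (x i)
        + (\<Sum>l\<in>{..<N} - {i}. poly (euler_quotient p (x l)) (x i))"
    using assms(1) by (simp add: sum.remove[of _ i])
  also have "(\<Sum>l\<in>{..<N} - {i}. poly (euler_quotient p (x l)) (x i))
      = (\<Sum>l\<in>{..<N} - {i}. x i * poly (pderiv p) (x i) * (1 / (x i - x l))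
          - x l * (poly p (x i) - poly p (x l)) / (x i - x l)\<^sup>2)"
  proof (rule sum.cong)
    fix l assume l: "l \<in> {..<N} - {i}"
    then have "x i \<noteq> x l" using assms(1,2) by (auto simp: inj_on_def)
    then show "poly (euler_quotient p (x l)) (x i) = x i * poly (pderiv p) (x i) * (1 / (x i - x l))
          - x l * (poly p (x i) - poly p (x l)) / (x i - x l)\<^sup>2"
      by (simp add: poly_euler_quotient)
  qed simp
  also have "\<dots> = x i * poly (pderiv p) (x i) * (1 / 4 - \<nu> / (2 * x i)) - s"
    by (simp only: sum_subtractf sum_distrib_left[symmetric] nodes s_def)
  also have "\<dots> = (x i / 4 - \<nu> / 2) * poly (pderiv p) (x i) - s"
    using assms(3) by (simp add: field_simps)
  finally have e: "(\<Sum>l<N. poly (euler_quotient p (x l)) (x i))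
      = poly (euler_quotient p (x i)) (x i) + ((x i / 4 - \<nu> / 2) * poly (pderiv p) (x i) - s)" .
  show ?thesis
    unfolding s_def[symmetric]
    by (simp add: node_operator_def poly_sum e poly_euler_quotient_diagonal algebra_simps)
qed

text \<open>
  The contribution of a pair of nodes to \<open>S v\<close>, with \<open>a = r\<^sub>i\<close> and \<open>b = r\<^sub>l\<close>. Up to the common
  factor \<open>a\<close>, only the squares of \<open>a\<close> and \<open>b\<close> remain.
\<close>
lemma pair_interaction_in_squares:
  fixes a b P Q :: real
  assumes "a - b \<noteq> 0" "a + b \<noteq> 0"
  shows "a * P * (2 / (a - b)\<^sup>2 + 2 / (a + b)\<^sup>2) + (2 / (a + b)\<^sup>2 - 2 / (a - b)\<^sup>2) * (b * Q)
    = 4 * a * P * (1 / (a\<^sup>2 - b\<^sup>2)) + a * (8 * (b\<^sup>2 * (P - Q) / (a\<^sup>2 - b\<^sup>2)\<^sup>2))"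
proof -
  \<comment> \<open>Naming the two factors of \<open>a\<^sup>2 - b\<^sup>2\<close> makes the common denominator the monomial \<open>(d e)\<^sup>2\<close>.\<close>
  define d e where "d = a - b" and "e = a + b"
  have sq: "a\<^sup>2 - b\<^sup>2 = d * e" by (simp add: d_def e_def power2_eq_square algebra_simps)
  have ne: "d \<noteq> 0" "e \<noteq> 0" using assms by (simp_all add: d_def e_def)
  have 1: "a * P * (2 / d\<^sup>2 + 2 / e\<^sup>2) + (2 / e\<^sup>2 - 2 / d\<^sup>2) * (b * Q)
    = (a * P * (2 * e\<^sup>2 + 2 * d\<^sup>2) + (2 * d\<^sup>2 - 2 * e\<^sup>2) * (b * Q)) / (d * e)\<^sup>2"
    using ne by (simp add: field_simps)
  have 2: "4 * a * P * (1 / (d * e)) + a * (8 * (b\<^sup>2 * (P - Q) / (d * e)\<^sup>2))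
    = (4 * a * P * (d * e) + a * (8 * (b\<^sup>2 * (P - Q)))) / (d * e)\<^sup>2"
    using ne by (simp add: field_simps power2_eq_square)
  have "a * P * (2 * e\<^sup>2 + 2 * d\<^sup>2) + (2 * d\<^sup>2 - 2 * e\<^sup>2) * (b * Q)
    = 4 * a * P * (d * e) + a * (8 * (b\<^sup>2 * (P - Q)))"
    by (simp add: d_def e_def power2_eq_square algebra_simps)
  then show ?thesis
    unfolding sq d_def[symmetric] e_def[symmetric] 1 2 by simp
qed

text \<open>
  As functions of \<open>r\<^sub>i\<close> the entries \<open>r\<^sub>i p(r\<^sub>i\<^sup>2)\<close> are odd polynomials, and \<open>S\<close> preserves this class of
  vectors. After the pairs have been combined, the reciprocal sum contributes
  \<open>4 p(x\<^sub>i) (1/4 - \<nu>/(2 x\<^sub>i)) = p(x\<^sub>i) (1 - 2\<nu>/x\<^sub>i)\<close>, which cancels the \<open>\<nu>\<close>-term of the diagonal of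
  \<open>S\<close> and leaves the summand \<open>2 p(x\<^sub>i)\<close> of the operator.
\<close>
lemma S_mat_mult_odd_vector:
  assumes z: "\<And>i. i < N \<Longrightarrow> 0 < x i" and inj: "inj_on x {..<N}"
    and nodes: "\<And>i. i < N \<Longrightarrow> (\<Sum>l\<in>{..<N} - {i}. 1 / (x i - x l)) = 1 / 4 - \<nu> / (2 * x i)"
  shows "S_mat N \<nu> (\<lambda>i. sqrt (x i)) *\<^sub>v Matrix.vec N (\<lambda>i. sqrt (x i) * poly p (x i))
    = Matrix.vec N (\<lambda>i. sqrt (x i) * poly (node_operator \<nu> N x p) (x i))"
proof (rule eq_vecI)
  define r where "r = (\<lambda>i. sqrt (x i))"
  define P where "P = (\<lambda>i. poly p (x i))"
  fix i assume "i < dim_vec (Matrix.vec N (\<lambda>i. sqrt (x i) * poly (node_operator \<nu> N x p) (x i)))"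
  then have i: "i < N" by simp
  let ?I = "{..<N} - {i}"
  have r: "r l > 0" "x l = (r l)\<^sup>2" if "l < N" for l using z[OF that] by (auto simp: r_def)
  define \<sigma> where "\<sigma> = (\<lambda>l. if i = l then
       1 + 2 * \<nu> / (r i)\<^sup>2 + 2 * (\<Sum>l\<in>?I. 1 / (r i - r l)\<^sup>2) + 2 * (\<Sum>l\<in>?I. 1 / (r i + r l)\<^sup>2)
     else 2 / (r i + r l)\<^sup>2 - 2 / (r i - r l)\<^sup>2)"
  have "(S_mat N \<nu> r *\<^sub>v Matrix.vec N (\<lambda>i. r i * P i)) $ i = (\<Sum>l<N. \<sigma> l * (r l * P l))"
    using i by (simp add: S_mat_def scalar_prod_def \<sigma>_def lessThan_atLeast0)
  also have "\<dots> = \<sigma> i * (r i * P i) + (\<Sum>l\<in>?I. \<sigma> l * (r l * P l))"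
    using i by (simp add: sum.remove[of _ i])
  also have "\<sigma> i * (r i * P i) = r i * P i * (1 + 2 * \<nu> / x i)
      + (\<Sum>l\<in>?I. r i * P i * (2 / (r i - r l)\<^sup>2 + 2 / (r i + r l)\<^sup>2))"
    unfolding r(2)[OF i] \<sigma>_def
    by (simp add: sum.distrib distrib_left distrib_right sum_distrib_left mult_ac)
  also have "(\<Sum>l\<in>?I. \<sigma> l * (r l * P l)) = (\<Sum>l\<in>?I. (2 / (r i + r l)\<^sup>2 - 2 / (r i - r l)\<^sup>2) * (r l * P l))"
    by (intro sum.cong) (auto simp: \<sigma>_def)
  also have "r i * P i * (1 + 2 * \<nu> / x i)
      + (\<Sum>l\<in>?I. r i * P i * (2 / (r i - r l)\<^sup>2 + 2 / (r i + r l)\<^sup>2))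
      + (\<Sum>l\<in>?I. (2 / (r i + r l)\<^sup>2 - 2 / (r i - r l)\<^sup>2) * (r l * P l))
    = r i * P i * (1 + 2 * \<nu> / x i)
      + (\<Sum>l\<in>?I. r i * P i * (2 / (r i - r l)\<^sup>2 + 2 / (r i + r l)\<^sup>2)
          + (2 / (r i + r l)\<^sup>2 - 2 / (r i - r l)\<^sup>2) * (r l * P l))"
    by (simp add: sum.distrib)
  also have "(\<Sum>l\<in>?I. r i * P i * (2 / (r i - r l)\<^sup>2 + 2 / (r i + r l)\<^sup>2)
          + (2 / (r i + r l)\<^sup>2 - 2 / (r i - r l)\<^sup>2) * (r l * P l))
    = (\<Sum>l\<in>?I. 4 * r i * P i * (1 / (x i - x l)) + r i * (8 * (x l * (P i - P l) / (x i - x l)\<^sup>2)))"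
  proof (rule sum.cong)
    fix l assume "l \<in> ?I"
    then have l: "l < N" "l \<noteq> i" by auto
    then have "x i \<noteq> x l" using inj i by (auto simp: inj_on_def)
    then have ne: "r i - r l \<noteq> 0" by (auto simp: r_def)
    have pos: "r i + r l \<noteq> 0" using r(1)[OF i] r(1)[OF l(1)] by simp
    show "r i * P i * (2 / (r i - r l)\<^sup>2 + 2 / (r i + r l)\<^sup>2)
          + (2 / (r i + r l)\<^sup>2 - 2 / (r i - r l)\<^sup>2) * (r l * P l)
        = 4 * r i * P i * (1 / (x i - x l)) + r i * (8 * (x l * (P i - P l) / (x i - x l)\<^sup>2))"
      using pair_interaction_in_squares[OF ne pos] by (simp only: r(2)[OF i] r(2)[OF l(1)])
  qed simp
  also have "\<dots> = 4 * r i * P i * (1 / 4 - \<nu> / (2 * x i))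
      + r i * (8 * (\<Sum>l\<in>?I. x l * (P i - P l) / (x i - x l)\<^sup>2))"
    by (simp only: sum.distrib sum_distrib_left[symmetric] nodes[OF i])
  also have "r i * P i * (1 + 2 * \<nu> / x i) + (4 * r i * P i * (1 / 4 - \<nu> / (2 * x i))
      + r i * (8 * (\<Sum>l\<in>?I. x l * (P i - P l) / (x i - x l)\<^sup>2)))
    = r i * poly (node_operator \<nu> N x p) (x i)"
    using z[OF i] i inj nodes[OF i] by (subst poly_node_operator) (auto simp: P_def field_simps)
  finally show "(S_mat N \<nu> (\<lambda>i. sqrt (x i)) *\<^sub>v Matrix.vec N (\<lambda>i. sqrt (x i) * poly p (x i))) $ i
    = Matrix.vec N (\<lambda>i. sqrt (x i) * poly (node_operator \<nu> N x p) (x i)) $ i"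
    using i by (simp add: r_def P_def)
qed (simp add: S_mat_def)

section \<open>Orthogonal polynomials on the nodes\<close>

text \<open>
  The inner product of \<open>dual_measure\<close> without its normalizing constant, for nodes \<open>x\<^sub>i = 2 z\<^sub>i\<close>.
\<close>
definition node_inner :: "nat \<Rightarrow> (nat \<Rightarrow> real) \<Rightarrow> real poly \<Rightarrow> real poly \<Rightarrow> real" where
  "node_inner N x p q = (\<Sum>i<N. x i * (poly p (x i) * poly q (x i)))"

lemma node_inner_commute: "node_inner N x p q = node_inner N x q p"
  by (simp add: node_inner_def mult.commute)

lemma node_inner_add_right: "node_inner N x p (q + q') = node_inner N x p q + node_inner N x p q'"
  by (simp add: node_inner_def distrib_left sum.distrib)

lemma node_inner_diff_left: "node_inner N x (p - p') q = node_inner N x p q - node_inner N x p' q"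
  by (simp add: node_inner_def algebra_simps sum_subtractf)

lemma node_inner_smult_left: "node_inner N x (Polynomial.smult c p) q = c * node_inner N x p q"
  by (simp add: node_inner_def sum_distrib_left mult_ac)

lemma node_inner_smult_right: "node_inner N x p (Polynomial.smult c q) = c * node_inner N x p q"
  by (simp add: node_inner_def sum_distrib_left mult_ac)

lemma node_inner_sum_left: "node_inner N x (\<Sum>j\<in>J. f j) q = (\<Sum>j\<in>J. node_inner N x (f j) q)"
  unfolding node_inner_def poly_sum sum_distrib_left sum_distrib_right by (rule sum.swap)

lemma node_inner_orthogonal_polys_below:
  assumes "\<And>j. j < k \<Longrightarrow> B j \<noteq> 0 \<and> degree (B j) = j"
    and "\<And>j. j < k \<Longrightarrow> node_inner N x p (B j) = 0" and "q \<in> polys_below k"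
  shows "node_inner N x p q = 0"
  by (rule linear_functional_eq_0_on_polys_below[of "node_inner N x p", OF _ _ assms(1,2,3)])
     (simp_all add: node_inner_add_right node_inner_smult_right)

text \<open>
  A nonzero polynomial of degree less than \<open>N\<close> cannot vanish at all of the \<open>N\<close> distinct nodes.
\<close>
lemma node_inner_self_pos:
  assumes pos: "\<And>i. i < N \<Longrightarrow> 0 < x i" and inj: "inj_on x {..<N}"
    and p: "p \<in> polys_below N" "p \<noteq> 0"
  shows "0 < node_inner N x p p"
proof -
  obtain i where i: "i < N" "poly p (x i) \<noteq> 0"
  proof (rule ccontr)
    assume "\<not> thesis"
    then have "x ` {..<N} \<subseteq> {y. poly p y = 0}" using that by auto
    then have "N \<le> degree p"
      using card_mono[OF poly_roots_finite[OF p(2)], of "x ` {..<N}"] card_poly_roots_bound[OF p(2)] inj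
      by (simp add: card_image)
    then have "lead_coeff p = 0" using p(1) by (rule polys_belowD[rotated])
    then show False using p(2) by simp
  qed
  then have "0 < x i * (poly p (x i) * poly p (x i))"
    using pos[OF i(1)] by (simp flip: power2_eq_square)
  then show ?thesis
    unfolding node_inner_def using i(1) pos by (intro sum_pos2[of _ i]) (auto simp: less_imp_le)
qed

text \<open>
  The Gram-Schmidt process. It is needed because the spectrum has to be determined without a given
  orthonormal family.
\<close>
lemma orthonormal_polynomial_exists:
  assumes pos: "\<And>i. i < N \<Longrightarrow> 0 < x i" and inj: "inj_on x {..<N}" and "k < N"
  shows "\<exists>p. p \<noteq> 0 \<and> degree p = k \<and> node_inner N x p p = 1 \<and> (\<forall>q\<in>polys_below k. node_inner N x p q = 0)"
  using \<open>k < N\<close>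
proof (induction k rule: less_induct)
  case (less k)
  then have "\<forall>j\<in>{..<k}. \<exists>p. p \<noteq> 0 \<and> degree p = j \<and> node_inner N x p p = 1
      \<and> (\<forall>q\<in>polys_below j. node_inner N x p q = 0)"
    by auto
  from bchoice[OF this] obtain B where B: "\<And>j. j < k \<Longrightarrow> B j \<noteq> 0" "\<And>j. j < k \<Longrightarrow> degree (B j) = j"
    "\<And>j. j < k \<Longrightarrow> node_inner N x (B j) (B j) = 1"
    "\<And>j q. j < k \<Longrightarrow> q \<in> polys_below j \<Longrightarrow> node_inner N x (B j) q = 0"
    by auto
  have BB: "node_inner N x (B j) (B m) = (if j = m then 1 else 0)" if "j < k" "m < k" for j m
  proof -
    have below: "B i \<in> polys_below n" if "i < k" "i < n" for i n
      using B(2) that polys_below_Suc_iff[of "B i" i] by (auto intro: polys_below_mono)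
    consider "j < m" | "j = m" | "m < j" by linarith
    then show ?thesis
      by cases (use that below B(3,4) node_inner_commute[of N x "B j" "B m"] in auto)
  qed
  \<comment> \<open>\<open>x\<^sup>k\<close> minus its projection onto the polynomials of lower degree.\<close>
  define w where "w = monom 1 k - (\<Sum>j<k. Polynomial.smult (node_inner N x (monom 1 k) (B j)) (B j))"
  have "coeff w i = coeff (monom 1 k) i" if "k \<le> i" for i
    using that B(2) by (auto simp: w_def coeff_sum coeff_eq_0 intro!: sum.neutral)
  then have w: "coeff w k = 1" "\<And>i. k < i \<Longrightarrow> coeff w i = 0" by auto
  then have deg: "degree w = k" by (intro antisym degree_le le_degree) auto
  have "w \<noteq> 0" using w(1) by auto
  have "w \<in> polys_below N"
    using deg less.prems polys_below_Suc_iff[of w k] by (auto intro: polys_below_mono)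
  with \<open>w \<noteq> 0\<close> have norm: "0 < node_inner N x w w" by (intro node_inner_self_pos pos inj)
  have w_B: "node_inner N x w (B m) = 0" if "m < k" for m
  proof -
    have "(\<Sum>j<k. node_inner N x (monom 1 k) (B j) * node_inner N x (B j) (B m))
        = (\<Sum>j<k. if j = m then node_inner N x (monom 1 k) (B j) else 0)"
      using that by (intro sum.cong) (auto simp: BB)
    then show ?thesis
      using that by (simp add: w_def node_inner_diff_left node_inner_sum_left node_inner_smult_left)
  qed
  have orth: "node_inner N x w q = 0" if "q \<in> polys_below k" for q
    by (rule node_inner_orthogonal_polys_below[of k B]) (simp_all add: B(1,2) w_B that)
  define c where "c = 1 / sqrt (node_inner N x w w)"
  have "c \<noteq> 0" "c * (c * node_inner N x w w) = 1"
    using norm by (auto simp: c_def field_simps)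
  then show ?case
    using deg \<open>w \<noteq> 0\<close> orth
    by (intro exI[of _ "Polynomial.smult c w"]) (auto simp: node_inner_smult_left node_inner_smult_right)
qed

section \<open>Eigenvectors and diagonalization\<close>

lemma scalar_prod_odd_vectors:
  assumes "\<And>i. i < N \<Longrightarrow> 0 < x i"
  shows "Matrix.vec N (\<lambda>i. sqrt (x i) * poly p (x i)) \<bullet> Matrix.vec N (\<lambda>i. sqrt (x i) * poly q (x i))
    = node_inner N x p q"
proof -
  have "sqrt (x i) * poly p (x i) * (sqrt (x i) * poly q (x i)) = x i * (poly p (x i) * poly q (x i))"
    if "i < N" for i
  proof -
    have "sqrt (x i) * poly p (x i) * (sqrt (x i) * poly q (x i))
        = (sqrt (x i) * sqrt (x i)) * (poly p (x i) * poly q (x i))" by (simp only: mult_ac)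
    then show ?thesis using assms[OF that] by simp
  qed
  then show ?thesis
    by (auto simp: scalar_prod_def node_inner_def lessThan_atLeast0 intro!: sum.cong)
qed

lemma S_mat_carrier: "S_mat N \<nu> r \<in> carrier_mat N N"
  by (simp add: S_mat_def)

lemma transpose_S_mat: "transpose_mat (S_mat N \<nu> r) = S_mat N \<nu> r"
  by (rule eq_matI) (auto simp: S_mat_def add.commute power2_commute)

text \<open>
  The symmetry of \<open>S\<close>, transported to polynomials: the two inner products agree by
  \<open>scalar_prod_odd_vectors\<close>.
\<close>
lemma node_operator_symmetric:
  assumes pos: "\<And>i. i < N \<Longrightarrow> 0 < x i" and inj: "inj_on x {..<N}"
    and nodes: "\<And>i. i < N \<Longrightarrow> (\<Sum>l\<in>{..<N} - {i}. 1 / (x i - x l)) = 1 / 4 - \<nu> / (2 * x i)"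
  shows "node_inner N x (node_operator \<nu> N x p) q = node_inner N x p (node_operator \<nu> N x q)"
proof -
  let ?v = "\<lambda>p. Matrix.vec N (\<lambda>i. sqrt (x i) * poly p (x i))"
  let ?S = "S_mat N \<nu> (\<lambda>i. sqrt (x i))"
  have "(transpose_mat ?S *\<^sub>v ?v p) \<bullet> ?v q = ?v p \<bullet> (?S *\<^sub>v ?v q)"
    by (rule transpose_vec_mult_scalar[OF S_mat_carrier]) auto
  then show ?thesis
    by (simp add: transpose_S_mat S_mat_mult_odd_vector[OF pos inj nodes] scalar_prod_odd_vectors[OF pos])
qed

text \<open>
  For \<open>q = A p - 2 (k + 1) p\<close> with \<open>k = degree p\<close>, both \<open>q\<close> and \<open>A q\<close> have degree less than \<open>k\<close> and are
  thus orthogonal to \<open>p\<close>. Moving one \<open>A\<close> to the other side shows that \<open>q\<close> is orthogonal to itself.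
\<close>
lemma eigenvector_of_orthogonal_polynomial:
  fixes p :: "real poly"
  assumes pos: "\<And>i. i < N \<Longrightarrow> 0 < x i" and inj: "inj_on x {..<N}"
    and nodes: "\<And>i. i < N \<Longrightarrow> (\<Sum>l\<in>{..<N} - {i}. 1 / (x i - x l)) = 1 / 4 - \<nu> / (2 * x i)"
    and p: "p \<noteq> 0" "degree p < N" "\<And>q. q \<in> polys_below (degree p) \<Longrightarrow> node_inner N x p q = 0"
  shows "eigenvector (S_mat N \<nu> (\<lambda>i. sqrt (x i))) (Matrix.vec N (\<lambda>i. sqrt (x i) * poly p (x i)))
    (2 * (real (degree p) + 1))"
proof -
  let ?A = "node_operator \<nu> N x" and ?v = "Matrix.vec N (\<lambda>i. sqrt (x i) * poly p (x i))"
  let ?c = "2 * (real (degree p) + 1)"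
  define q where "q = ?A p - Polynomial.smult ?c p"
  have q: "q \<in> polys_below (degree p)"
    unfolding q_def by (rule node_operator_triangular) simp
  have "node_inner N x q q = node_inner N x (?A p) q - ?c * node_inner N x p q"
    unfolding q_def[symmetric] by (subst (1) q_def) (simp add: node_inner_diff_left node_inner_smult_left)
  also have "\<dots> = node_inner N x p (?A q) - ?c * node_inner N x p q"
    by (simp add: node_operator_symmetric[OF pos inj nodes])
  also have "\<dots> = 0"
    using p(3)[OF q] p(3)[OF node_operator_degree[OF q]] by simp
  finally have "q = 0"
    using node_inner_self_pos[OF pos inj polys_below_mono[OF q less_imp_le[OF p(2)]]] by force
  then have "?A p = Polynomial.smult ?c p" by (simp add: q_def)
  then have "S_mat N \<nu> (\<lambda>i. sqrt (x i)) *\<^sub>v ?v = ?c \<cdot>\<^sub>v ?v"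
    by (subst S_mat_mult_odd_vector[OF pos inj nodes]) (auto intro!: eq_vecI)
  moreover have "?v \<noteq> 0\<^sub>v N"
  proof
    assume "?v = 0\<^sub>v N"
    then have "node_inner N x p p = 0"
      using scalar_prod_odd_vectors[of N x p p, OF pos] by simp
    moreover have "p \<in> polys_below N"
      using p(2) polys_below_Suc_iff[of p "degree p"] by (auto intro: polys_below_mono)
    ultimately show False using node_inner_self_pos[OF pos inj _ p(1)] by force
  qed
  ultimately show ?thesis by (simp add: eigenvector_def S_mat_def)
qed

lemma integral_dual_measure:
  fixes f :: "real \<Rightarrow> real"
  assumes "\<nu> > 0" "\<And>i. i < N \<Longrightarrow> 0 < z i" "f \<in> borel_measurable borel"
  shows "(LINT x|dual_measure N \<nu> z. f x)
    = (\<Sum>i<N. 2 * z i * f (2 * z i)) / (2 * real N * (real N + \<nu> - 1))"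
proof -
  let ?w = "\<lambda>i. 2 * z i / (2 * real N * (real N + \<nu> - 1))"
  have w: "0 \<le> ?w i" if "i < N" for i
    using assms(1,2) that by (intro divide_nonneg_nonneg mult_nonneg_nonneg) (auto simp: less_imp_le)
  have "(LINT x|dual_measure N \<nu> z. f x) = (LINT i|point_measure {..<N} ?w. f (2 * z i))"
    unfolding dual_measure_def using assms(3) by (intro integral_distr) auto
  also have "\<dots> = (\<Sum>i<N. ?w i * f (2 * z i))"
    using w by (subst lebesgue_integral_point_measure_finite) auto
  finally show ?thesis by (simp add: sum_divide_distrib)
qed

lemma dual_laguerre_system_orthonormal:
  assumes "\<nu> > 0" "\<And>i. i < N \<Longrightarrow> 0 < z i" "dual_laguerre_system N \<nu> z P" "j < N" "k < N"
  shows "node_inner N (\<lambda>i. 2 * z i) (P j) (P k) = (if j = k then 1 else 0)"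
proof (cases "j = k")
  case True
  then show ?thesis
    using assms(3,5) by (auto simp: dual_laguerre_system_def node_inner_def power2_eq_square)
next
  case False
  have "0 < 2 * real N * (real N + \<nu> - 1)" using assms(1,4) by auto
  moreover have "(LINT x|dual_measure N \<nu> z. poly (P j) x * poly (P k) x) = 0"
    using assms(3-5) False by (auto simp: dual_laguerre_system_def)
  ultimately show ?thesis
    using False by (subst (asm) integral_dual_measure[OF assms(1,2)])
      (auto simp: node_inner_def intro!: borel_measurable_continuous_onI continuous_intros)
qed

lemma real_orthogonal_matI:
  assumes "T \<in> carrier_mat n n" "transpose_mat T * T = 1\<^sub>m n"
  shows "real_orthogonal_mat T"
  using assms mat_mult_left_right_inverse[of "transpose_mat T" n T]
  by (auto simp: real_orthogonal_mat_def)

lemma orthogonal_diagonalization: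
  assumes S: "S \<in> carrier_mat n n" and T: "T \<in> carrier_mat n n" "real_orthogonal_mat T"
    and eig: "\<And>k. k < n \<Longrightarrow> S *\<^sub>v col T k = d k \<cdot>\<^sub>v col T k"
  shows "S = T * mat_diag n d * transpose_mat T"
proof -
  have "S * T = T * mat_diag n d"
  proof (rule eq_matI)
    fix i k assume "i < dim_row (T * mat_diag n d)" "k < dim_col (T * mat_diag n d)"
    then have ik: "i < n" "k < n" using T(1) by (auto simp: mat_diag_def)
    then have "(S * T) $$ (i, k) = vec_index (S *\<^sub>v col T k) i" using S T(1) by simp
    also have "\<dots> = T $$ (i, k) * d k" unfolding eig[OF ik(2)] using ik T(1) by simp
    finally show "(S * T) $$ (i, k) = (T * mat_diag n d) $$ (i, k)"
      using ik T(1) by (simp add: mat_diag_mult_right)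
  qed (use S T(1) in \<open>auto simp: mat_diag_def\<close>)
  moreover have "S = S * (T * transpose_mat T)"
    using S T by (simp add: real_orthogonal_mat_def)
  ultimately show ?thesis
    using S T(1) assoc_mult_mat[of S n n T n "transpose_mat T" n] by simp
qed

theorem theorem4p3:
  fixes \<nu> :: real and N :: nat and L :: "nat \<Rightarrow> real poly" and z r :: "nat \<Rightarrow> real"
  assumes "\<nu> > 0" and "N \<ge> 2"
    and "laguerre_system (\<nu> - 1) L"
    and "ordered_positive_zeros (L N) N z"
  defines "r \<equiv> \<lambda>i. sqrt (2 * z i)"
  shows "spectrum (S_mat N \<nu> r) = (\<lambda>m. 2 * real m) ` {1..N} \<and>
    (\<forall>P. dual_laguerre_system N \<nu> z P \<longrightarrow>
       (\<forall>k<N. eigenvector (S_mat N \<nu> r) (T_col N r P k) (2 * (real k + 1))) \<and>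
       real_orthogonal_mat (T_mat N r P) \<and>
       S_mat N \<nu> r =
         T_mat N r P * mat_diag N (\<lambda>k. 2 * (real k + 1)) * transpose_mat (T_mat N r P))"
proof (intro conjI allI impI)
  define x where "x = (\<lambda>i. 2 * z i)"
  have z_pos: "\<And>i. i < N \<Longrightarrow> 0 < z i" using assms(4) by (simp add: ordered_positive_zeros_def)
  then have pos: "\<And>i. i < N \<Longrightarrow> 0 < x i" by (simp add: x_def)
  have inj: "inj_on x {..<N}"
    using assms(4) unfolding ordered_positive_zeros_def inj_on_def x_def
    by (auto) (metis less_irrefl nat_neq_iff)
  have nodes: "(\<Sum>l\<in>{..<N} - {i}. 1 / (x i - x l)) = 1 / 4 - \<nu> / (2 * x i)" if "i < N" for i
  proof -
    have "(\<Sum>l\<in>{..<N} - {i}. 1 / (x i - x l)) = (\<Sum>l\<in>{..<N} - {i}. 1 / (z i - z l)) / 2"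
      by (simp add: x_def sum_divide_distrib field_simps flip: right_diff_distrib)
    then show ?thesis
      using laguerre_zeros_sum_reciprocal[OF assms(1,3,4) that] by (simp add: x_def)
  qed
  have r: "r = (\<lambda>i. sqrt (x i))" by (simp add: r_def x_def)
  have r2: "(r i)\<^sup>2 = x i" if "i < N" for i using pos[OF that] by (simp add: r)
  note eigen = eigenvector_of_orthogonal_polynomial[OF pos inj nodes, folded r]
  let ?S = "S_mat N \<nu> r"

  \<comment> \<open>The inclusion of \<open>N\<close> eigenvalues suffices, as the spectrum has at most \<open>N\<close> elements.\<close>
  have "2 * (real k + 1) \<in> spectrum ?S" if k: "k < N" for k
  proof -
    obtain p where "p \<noteq> 0" "degree p = k" "\<forall>q\<in>polys_below k. node_inner N x p q = 0"
      using orthonormal_polynomial_exists[OF pos inj k] by blast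
    then show ?thesis
      using eigen[of p] k by (auto simp: spectrum_def eigenvalue_def)
  qed
  moreover have "(\<lambda>m. 2 * real m) ` {1..N} = (\<lambda>k. 2 * (real k + 1)) ` {..<N}"
  proof -
    have "{1..N} = Suc ` {..<N}" by (simp add: lessThan_atLeast0 atLeastLessThanSuc_atLeastAtMost)
    then show ?thesis by (simp add: image_image add.commute)
  qed
  ultimately have sub: "(\<lambda>m. 2 * real m) ` {1..N} \<subseteq> spectrum ?S" by auto
  have "card ((\<lambda>m. 2 * real m) ` {1..N}) = N" by (subst card_image) (auto simp: inj_on_def)
  then show "spectrum ?S = (\<lambda>m. 2 * real m) ` {1..N}"
    using card_finite_spectrum[OF S_mat_carrier, of N \<nu> r] sub card_seteq by metis

  fix P assume P: "dual_laguerre_system N \<nu> z P"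
  have ortho: "node_inner N x (P j) (P k) = (if j = k then 1 else 0)" if "j < N" "k < N" for j k
    using dual_laguerre_system_orthonormal[OF assms(1) z_pos P that] by (simp add: x_def)
  have deg: "degree (P k) = k" "P k \<noteq> 0" if "k < N" for k
    using P that by (auto simp: dual_laguerre_system_def)
  have T_col: "T_col N r P k = Matrix.vec N (\<lambda>i. sqrt (x i) * poly (P k) (x i))" for k
    unfolding T_col_def by (rule eq_vecI) (simp_all only: index_vec dim_vec r2, simp add: r)
  have col: "col (T_mat N r P) k = T_col N r P k" if "k < N" for k
    using that by (intro eq_vecI) (auto simp: T_mat_def T_col_def)
  have T: "T_mat N r P \<in> carrier_mat N N" by (simp add: T_mat_def)
  show ev: "eigenvector ?S (T_col N r P k) (2 * (real k + 1))" if k: "k < N" for k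
  proof -
    have "node_inner N x (P k) q = 0" if "q \<in> polys_below k" for q
      by (rule node_inner_orthogonal_polys_below[of k P]) (use k that in \<open>auto simp: deg ortho\<close>)
    then show ?thesis using eigen[of "P k"] deg k by (simp add: T_col)
  qed
  have "transpose_mat (T_mat N r P) * T_mat N r P = 1\<^sub>m N"
    using T by (intro eq_matI) (auto simp: col T_col scalar_prod_odd_vectors[OF pos] ortho)
  with T show orth: "real_orthogonal_mat (T_mat N r P)" by (rule real_orthogonal_matI)
  show "?S = T_mat N r P * mat_diag N (\<lambda>k. 2 * (real k + 1)) * transpose_mat (T_mat N r P)"
    using ev by (intro orthogonal_diagonalization S_mat_carrier T orth) (auto simp: col eigenvector_def)
qed

end
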